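(* Let $\Omega = [0,1]^2$ and let $\mathcal{O}$ be an opaque set for $\Omega$ of length $L$. Then, for all $\eta > 0$, at least one of the following holds: (1) $L \geq 2 + \eta$; or (2) for every $0 \leq \beta \leq \pi/4$, $$ \mu_{\mathcal{O}}(J_{\beta}) \leq \frac{\eta}{1 - \cos(\beta)},$$ where $$ J_{\beta} = \left[\beta, \tfrac{\pi}{2} - \beta\right] \cup \left[\tfrac{\pi}{2} + \beta, \pi - \beta\right] \cup \left[\pi + \beta, \tfrac{3\pi}{2} - \beta\right] \cup \left[\tfrac{3\pi}{2} + \beta, 2\pi - \beta\right]$$ (angles modulo $2\pi$) is the set of angles at distance at least $\beta$ from both sides of the $x$-axis and the $y$-axis, and for $\beta=0$ the right-hand side is interpreted as $+\infty$.
   Context: A set $\mathcal{O}\subset\mathbb{R}^2$ is an opaque set for $\Omega$ if every line in $\mathbb{R}^2$ that intersects $\Omega$ also intersects $\mathcal{O}$. Opaque sets are assumed to be given as a countable union of line segments $\ell_i$ (overlapping only in sets of zero $\mathcal{H}^1$-measure) of lengths $|\ell_i|$, with total length $L=\sum_i|\ell_i|=\mathcal{H}^1(\mathcal{O})$. If the segment $\ell_i$ makes angle $\alpha_i$ with the $x$-axis (counterclockwise), the angular orientation measure of $\mathcal{O}$ is the measure on $[0,2\pi)$ (angles modulo $2\pi$) $$\mu_{\mathcal{O}}=\sum_i \frac{|\ell_i|}{2}\left(\delta_{\alpha_i}+\delta_{\alpha_i+\pi}\right),$$ which has total mass $L$. *)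

theory Defs
  imports "HOL-Analysis.Analysis" "HOL-Library.Real_Mod"
begin

section \<open>Opaque sets\<close>

definition is_line :: "(real^2) set \<Rightarrow> bool" where
  "is_line l \<longleftrightarrow> (\<exists>x y. x \<noteq> y \<and> l = affine hull {x, y})"

definition opaque_for :: "(real^2) set \<Rightarrow> (real^2) set \<Rightarrow> bool" where
  "opaque_for \<O> \<Omega> \<longleftrightarrow> (\<forall>l. is_line l \<and> l \<inter> \<Omega> \<noteq> {} \<longrightarrow> l \<inter> \<O> \<noteq> {})"

definition unit_square :: "(real^2) set" where
  "unit_square = {x. 0 \<le> x $ 1 \<and> x $ 1 \<le> 1 \<and> 0 \<le> x $ 2 \<and> x $ 2 \<le> 1}"


section \<open>One-dimensional Hausdorff (outer) measure\<close>

text \<open>The covering sets are required to be bounded because \<^const>\<open>diameter\<close> is meaningless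
  on unbounded sets. With this normalisation a segment has measure equal to its length.\<close>

definition hausdorff1_pre :: "real \<Rightarrow> 'a::metric_space set \<Rightarrow> ennreal" where
  "hausdorff1_pre \<delta> A =
     (INF U \<in> {U :: nat \<Rightarrow> 'a set. A \<subseteq> (\<Union>n. U n) \<and> (\<forall>n. bounded (U n) \<and> diameter (U n) \<le> \<delta>)}.
        \<Sum>n. ennreal (diameter (U n)))"

definition hausdorff1 :: "'a::metric_space set \<Rightarrow> ennreal" where
  "hausdorff1 A = (SUP \<delta>\<in>{0<..}. hausdorff1_pre \<delta> A)"


section \<open>Countable families of segments\<close>

text \<open>The \<open>i\<close>-th segment has end points \<open>p i\<close> and \<open>q i\<close>; the index set may be finite.\<close>

definition segment_family :: "'i set \<Rightarrow> ('i \<Rightarrow> real^2) \<Rightarrow> ('i \<Rightarrow> real^2) \<Rightarrow> bool" where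
  "segment_family I p q \<longleftrightarrow>
     countable I \<and> (\<forall>i\<in>I. p i \<noteq> q i) \<and>
     (\<forall>i\<in>I. \<forall>j\<in>I. i \<noteq> j \<longrightarrow>
        hausdorff1 (closed_segment (p i) (q i) \<inter> closed_segment (p j) (q j)) = 0)"

definition segments_union :: "'i set \<Rightarrow> ('i \<Rightarrow> real^2) \<Rightarrow> ('i \<Rightarrow> real^2) \<Rightarrow> (real^2) set" where
  "segments_union I p q = (\<Union>i\<in>I. closed_segment (p i) (q i))"

definition total_length :: "'i set \<Rightarrow> ('i \<Rightarrow> real^2) \<Rightarrow> ('i \<Rightarrow> real^2) \<Rightarrow> ennreal" where
  "total_length I p q = (\<Sum>\<^sub>\<infinity>i\<in>I. ennreal (dist (p i) (q i)))"


section \<open>Angular orientation measure\<close>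

definition seg_angle :: "real^2 \<Rightarrow> real^2 \<Rightarrow> real" where
  "seg_angle x y = Arg2pi (Complex ((y - x) $ 1) ((y - x) $ 2))"

definition orientation_measure ::
    "'i set \<Rightarrow> ('i \<Rightarrow> real^2) \<Rightarrow> ('i \<Rightarrow> real^2) \<Rightarrow> real measure" where
  "orientation_measure I p q =
     measure_of {0..<2*pi} (sets (restrict_space borel {0..<2*pi}))
       (\<lambda>A. \<Sum>\<^sub>\<infinity>i\<in>I. ennreal (dist (p i) (q i) / 2) *
          (indicator A (seg_angle (p i) (q i))
           + indicator A ((seg_angle (p i) (q i) + pi) rmod (2*pi))))"

text \<open>The image reduces angles modulo \<open>2\<pi>\<close>; it only matters for \<open>\<beta> = 0\<close>.\<close>

definition J_set :: "real \<Rightarrow> real set" where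
  "J_set \<beta> = (\<lambda>\<theta>. \<theta> rmod (2*pi)) `
     ({\<beta> .. pi/2 - \<beta>} \<union> {pi/2 + \<beta> .. pi - \<beta>} \<union>
      {pi + \<beta> .. 3*pi/2 - \<beta>} \<union> {3*pi/2 + \<beta> .. 2*pi - \<beta>})"


section \<open>The set function above is a measure, of total mass the total length\<close>

lemma infsum_eq_nn_integral_count_space:
  fixes f :: "'i \<Rightarrow> ennreal"
  assumes "countable I"
  shows "(\<Sum>\<^sub>\<infinity>i\<in>I. f i) = (\<integral>\<^sup>+i. f i \<partial>count_space I)"
proof (cases "finite I")
  case True
  then show ?thesis
    by (simp add: nn_integral_count_space_finite)
next
  case False
  have bij: "bij_betw (from_nat_into I) UNIV I"
    using assms False by (rule bij_betw_from_nat_into)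
  have "(\<Sum>\<^sub>\<infinity>i\<in>I. f i) = (\<Sum>\<^sub>\<infinity>n. f (from_nat_into I n))"
    by (rule infsum_reindex_bij_betw[OF bij, symmetric])
  also have "((\<lambda>n. f (from_nat_into I n)) has_sum (\<Sum>\<^sub>\<infinity>n. f (from_nat_into I n))) UNIV"
    by (intro has_sum_infsum nonneg_summable_on_complete) auto
  then have "(\<Sum>\<^sub>\<infinity>n. f (from_nat_into I n)) = (\<Sum>n. f (from_nat_into I n))"
    by (intro sums_unique has_sum_imp_sums)
  also have "\<dots> = (\<integral>\<^sup>+n. f (from_nat_into I n) \<partial>count_space UNIV)"
    by (simp add: nn_integral_count_space_nat)
  also have "\<dots> = (\<integral>\<^sup>+i. f i \<partial>count_space I)"
    by (rule nn_integral_bij_count_space[OF bij])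
  finally show ?thesis .
qed

lemma space_orientation_measure: "space (orientation_measure I p q) = {0..<2*pi}"
  by (simp add: orientation_measure_def space_measure_of_conv)

lemma sets_orientation_measure:
  "sets (orientation_measure I p q) = sets (restrict_space borel {0..<2*pi})"
  using sets.sigma_sets_eq[of "restrict_space borel {0..<2*pi::real}"]
    sets.space_closed[of "restrict_space borel {0..<2*pi::real}"]
  by (simp add: orientation_measure_def space_restrict_space)

lemma emeasure_orientation_measure:
  assumes "countable I" and A: "A \<in> sets (restrict_space borel {0..<2*pi})"
  shows "emeasure (orientation_measure I p q) A =
    (\<Sum>\<^sub>\<infinity>i\<in>I. ennreal (dist (p i) (q i) / 2) *
       (indicator A (seg_angle (p i) (q i))
        + indicator A ((seg_angle (p i) (q i) + pi) rmod (2*pi))))"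
proof -
  let ?B = "restrict_space borel {0..<2*pi::real}"
  let ?F = "\<lambda>A i. ennreal (dist (p i) (q i) / 2) *
          (indicator A (seg_angle (p i) (q i))
           + indicator A ((seg_angle (p i) (q i) + pi) rmod (2*pi))) :: ennreal"
  have sp: "space ?B = {0..<2*pi}" by (simp add: space_restrict_space)
  have sig: "sigma_algebra {0..<2*pi} (sets ?B)"
    using sets.sigma_algebra_axioms[of ?B] by (simp add: sp)
  have "countably_additive (sets ?B) (\<lambda>A. infsum (?F A) I)"
  proof (rule countably_additiveI)
    fix S :: "nat \<Rightarrow> real set"
    assume "range S \<subseteq> sets ?B" and d: "disjoint_family S"
    have "(\<Sum>n. infsum (?F (S n)) I) = (\<integral>\<^sup>+i. (\<Sum>n. ?F (S n) i) \<partial>count_space I)"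
      unfolding infsum_eq_nn_integral_count_space[OF assms(1)]
      by (rule nn_integral_suminf[symmetric]) simp
    also have "\<dots> = (\<integral>\<^sup>+i. ?F (\<Union>n. S n) i \<partial>count_space I)"
      by (simp add: suminf_add[symmetric] suminf_indicator[OF d])
    also have "\<dots> = infsum (?F (\<Union>n. S n)) I"
      by (simp add: infsum_eq_nn_integral_count_space[OF assms(1)])
    finally show "(\<Sum>n. infsum (?F (S n)) I) = infsum (?F (\<Union>n. S n)) I" .
  qed
  moreover have "positive (sets ?B) (\<lambda>A. infsum (?F A) I)"
    by (simp add: positive_def)
  ultimately show ?thesis
    unfolding orientation_measure_def
    by (intro emeasure_measure_of_sigma[OF sig _ _ A])
qed

lemma orientation_measure_total_mass:
  assumes "countable I"
  shows "emeasure (orientation_measure I p q) {0..<2*pi} = total_length I p q"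
proof -
  have "{0..<2*pi} \<in> sets (restrict_space borel {0..<2*pi::real})"
    by (simp add: sets_restrict_space_iff)
  moreover have "seg_angle x y \<in> {0..<2*pi}" for x y
    by (simp add: seg_angle_def Arg2pi_ge_0 Arg2pi_lt_2pi)
  moreover have "t rmod (2*pi) \<in> {0..<2*pi}" for t
    by (simp add: rmod_nonneg rmod_less)
  moreover have "ennreal (d / 2) * 2 = ennreal d" if "0 \<le> d" for d
    using that by (simp add: ennreal_mult'[symmetric] flip: ennreal_numeral)
  ultimately show ?thesis
    by (simp add: emeasure_orientation_measure[OF assms] total_length_def one_add_one
        del: atLeastLessThan_iff)
qed

lemma J_set_measurable:
  assumes "0 < \<beta>"
  shows "J_set \<beta> = {\<beta> .. pi/2 - \<beta>} \<union> {pi/2 + \<beta> .. pi - \<beta>} \<union>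
      {pi + \<beta> .. 3*pi/2 - \<beta>} \<union> {3*pi/2 + \<beta> .. 2*pi - \<beta>}" (is "_ = ?J")
    and "J_set \<beta> \<in> sets (orientation_measure I p q)"
proof -
  have sub: "?J \<subseteq> {0..<2*pi}"
    using assms pi_gt_zero by (auto simp: field_simps)
  have "\<theta> rmod (2*pi) = \<theta>" if "\<theta> \<in> ?J" for \<theta>
    using subsetD[OF sub that] by (intro rmod_idem) auto
  then show eq: "J_set \<beta> = ?J"
    unfolding J_set_def by (simp only: image_cong[OF refl, of ?J _ "\<lambda>\<theta>. \<theta>"] image_ident)
  have "?J \<in> sets borel" by measurable
  then show "J_set \<beta> \<in> sets (orientation_measure I p q)"
    using sub unfolding eq sets_orientation_measure
    by (subst sets_restrict_space_iff) auto
qed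

end

(* Projecting onto the two diagonal directions, opacity gives \<Sum> |dx + dy| \<ge> 2 and
   \<Sum> |dx - dy| \<ge> 2 over the segments, where (dx, dy) is the displacement along a segment. Since
   |dx + dy| + |dx - dy| = 2 max |dx| |dy|, the total of max |dx| |dy| is at least 2. A segment with
   angle in J \<beta> contributes at most cos \<beta> times its length to this total, so
   2 + (1 - cos \<beta>) \<mu> (J \<beta>) \<le> L. *)
theory Submission
  imports Defs
begin

text \<open>The indicator of the union is at most the sum of the indicators, since a covered point
  lies in some \<open>S j\<close>; integrating and exchanging sum and integral gives subadditivity.
  Writing the sum as an integral over \<open>count_space I\<close> treats finite and infinite index
  sets alike.\<close>

lemma emeasure_UN_le_nn_integral_count_space:
  assumes "countable I" and S: "\<And>i. i \<in> I \<Longrightarrow> S i \<in> sets M"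
  shows "emeasure M (\<Union>i\<in>I. S i) \<le> (\<integral>\<^sup>+i. emeasure M (S i) \<partial>count_space I)"
proof -
  have "emeasure M (\<Union>i\<in>I. S i) = (\<integral>\<^sup>+x. indicator (\<Union>i\<in>I. S i) x \<partial>M)"
    using assms by (intro nn_integral_indicator[symmetric] sets.countable_UN') auto
  also have "\<dots> \<le> (\<integral>\<^sup>+x. (\<integral>\<^sup>+i. indicator (S i) x \<partial>count_space I) \<partial>M)"
  proof (rule nn_integral_mono)
    fix x
    show "indicator (\<Union>i\<in>I. S i) x \<le> (\<integral>\<^sup>+i. indicator (S i) x \<partial>count_space I)"
    proof (cases "x \<in> (\<Union>i\<in>I. S i)")
      case True
      then obtain j where j: "j \<in> I" "x \<in> S j" by blast
      then have "indicator (S j) x \<le> (\<integral>\<^sup>+i. indicator (S i) x \<partial>count_space I)"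
        by (intro nn_integral_ge_point)
      with j True show ?thesis by simp
    qed simp
  qed
  also have "\<dots> = (\<integral>\<^sup>+i. (\<integral>\<^sup>+x. indicator (S i) x \<partial>M) \<partial>count_space I)"
    using S by (intro nn_integral_count_space_nn_integral[OF assms(1)]) simp
  also have "\<dots> = (\<integral>\<^sup>+i. emeasure M (S i) \<partial>count_space I)"
    using S by (intro nn_integral_cong) simp
  finally show ?thesis .
qed

text \<open>The level set of the functional \<open>(\<bullet>) w\<close> through a point of \<Omega>
  is a line meeting \<Omega>, so it contains a point of the opaque set, where the functional takes
  the same value.\<close>

lemma opaque_for_inner_image:
  fixes w :: "real^2"
  assumes "opaque_for \<O> \<Omega>" and "w \<noteq> 0"
  shows "(\<bullet>) w ` \<Omega> \<subseteq> (\<bullet>) w ` \<O>"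
proof (rule image_subsetI)
  fix a assume a: "a \<in> \<Omega>"
  \<comment> \<open>A quarter turn of \<open>w\<close>: the direction of the level lines.\<close>
  define v :: "real^2" where "v = vector [- w $ 2, w $ 1]"
  have v: "v \<noteq> 0" "w \<bullet> v = 0"
    using assms(2) by (auto simp: v_def vec_eq_iff forall_2 vector_2 inner_vec_def sum_2)
  have "is_line (affine hull {a, a + v})"
    unfolding is_line_def using v(1) by (metis add_cancel_right_right)
  moreover have "a \<in> affine hull {a, a + v}"
    by (simp add: hull_inc)
  ultimately obtain b where b: "b \<in> \<O>" "b \<in> affine hull {a, a + v}"
    using assms(1) a unfolding opaque_for_def by blast
  then obtain s t where b_eq: "b = s *\<^sub>R a + t *\<^sub>R (a + v)" and "s + t = 1"
    unfolding affine_hull_2 by blast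
  have "w \<bullet> b = (s + t) * (w \<bullet> a)"
    unfolding b_eq using v(2) by (simp add: inner_add_right algebra_simps)
  with \<open>s + t = 1\<close> b(1) show "w \<bullet> a \<in> (\<bullet>) w ` \<O>"
    by (intro image_eqI[of _ _ b]) simp_all
qed

text \<open>By opacity the projected segments cover the interval, and each projects onto an interval
  of length \<open>\<bar>w \<bullet> (q i - p i)\<bar>\<close>; subadditivity of Lebesgue measure
  does the rest. As \<open>w\<close> need not be a unit vector, these are scaled
  projections.\<close>

lemma emeasure_inner_image_le:
  assumes "countable I" and "opaque_for (segments_union I p q) \<Omega>" and "w \<noteq> 0"
    and "{a..b} \<subseteq> (\<bullet>) w ` \<Omega>"
  shows "ennreal (b - a) \<le> (\<integral>\<^sup>+i. ennreal \<bar>w \<bullet> (q i - p i)\<bar> \<partial>count_space I)"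
proof (cases "a \<le> b")
  case True
  have img: "(\<bullet>) w ` closed_segment (p i) (q i) = closed_segment (w \<bullet> p i) (w \<bullet> q i)" for i
    by (rule closed_segment_linear_image[symmetric])
      (simp add: bounded_linear.linear bounded_linear_inner_right)
  have "ennreal (b - a) = emeasure lborel {a..b}"
    using True by simp
  also have "{a..b} \<subseteq> (\<Union>i\<in>I. closed_segment (w \<bullet> p i) (w \<bullet> q i))"
    using assms(4) opaque_for_inner_image[OF assms(2,3)]
    by (simp add: segments_union_def image_UN img)
  then have "emeasure lborel {a..b}
      \<le> emeasure lborel (\<Union>i\<in>I. closed_segment (w \<bullet> p i) (w \<bullet> q i))"
    using assms(1) by (intro emeasure_mono sets.countable_UN') auto
  also have "\<dots> \<le> (\<integral>\<^sup>+i. emeasure lborel (closed_segment (w \<bullet> p i) (w \<bullet> q i)) \<partial>count_space I)"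
    using assms(1) by (intro emeasure_UN_le_nn_integral_count_space) auto
  also have "\<dots> = (\<integral>\<^sup>+i. ennreal \<bar>w \<bullet> (q i - p i)\<bar> \<partial>count_space I)"
    by (intro nn_integral_cong) (auto simp: closed_segment_eq_real_ivl inner_diff_right)
  finally show ?thesis .
\<comment> \<open>For \<open>b < a\<close> the left-hand side truncates to 0.\<close>
qed (simp add: ennreal_neg)

lemma unit_square_max_sum:
  assumes "countable I" and op: "opaque_for (segments_union I p q) unit_square"
  shows "2 \<le> (\<integral>\<^sup>+i. ennreal (max \<bar>(q i - p i) $ 1\<bar> \<bar>(q i - p i) $ 2\<bar>) \<partial>count_space I)"
    (is "2 \<le> ?R")
proof -
  \<comment> \<open>Left unnormalised, both diagonal functionals map the square onto intervals of
    length 2, and no square roots appear.\<close>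
  let ?u = "vector [1, 1] :: real^2" and ?v = "vector [1, -1] :: real^2"
  have u: "?u \<bullet> x = x $ 1 + x $ 2" and v: "?v \<bullet> x = x $ 1 - x $ 2" for x
    by (simp_all add: inner_vec_def sum_2 vector_2)
  have diag: "\<bar>x + y\<bar> + \<bar>x - y\<bar> = 2 * max \<bar>x\<bar> \<bar>y\<bar>" for x y :: real
    by linarith
  have "?u \<noteq> 0" "?v \<noteq> 0"
    by (simp_all add: vec_eq_iff forall_2 vector_2)
  moreover have "{0..2} \<subseteq> (\<bullet>) ?u ` unit_square"
  proof
    fix c :: real assume "c \<in> {0..2}"
    then show "c \<in> (\<bullet>) ?u ` unit_square"
      \<comment> \<open>The witness lies on the main diagonal of the square.\<close>
      by (intro image_eqI[of _ _ "vector [c/2, c/2]"])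
        (auto simp: u unit_square_def vector_2)
  qed
  moreover have "{-1..1} \<subseteq> (\<bullet>) ?v ` unit_square"
  proof
    fix c :: real assume "c \<in> {-1..1}"
    then show "c \<in> (\<bullet>) ?v ` unit_square"
      \<comment> \<open>The witness lies on the other diagonal, where the coordinates sum to
        1.\<close>
      by (intro image_eqI[of _ _ "vector [(1 + c)/2, (1 - c)/2]"])
        (auto simp: v unit_square_def vector_2 field_simps)
  qed
  ultimately have "ennreal (2 - 0) + ennreal (1 - - 1) \<le>
      (\<integral>\<^sup>+i. ennreal \<bar>?u \<bullet> (q i - p i)\<bar> \<partial>count_space I)
      + (\<integral>\<^sup>+i. ennreal \<bar>?v \<bullet> (q i - p i)\<bar> \<partial>count_space I)"
    using assms by (intro add_mono emeasure_inner_image_le) auto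
  also have "\<dots> = (\<integral>\<^sup>+i. ennreal 2 * ennreal (max \<bar>(q i - p i) $ 1\<bar> \<bar>(q i - p i) $ 2\<bar>) \<partial>count_space I)"
    unfolding u v
    by (subst nn_integral_add[symmetric])
      (auto intro!: nn_integral_cong arg_cong[where f = ennreal] diag
        simp flip: ennreal_plus ennreal_mult' simp del: ennreal_numeral)
  also have "\<dots> = ennreal 2 * ?R"
    by (rule nn_integral_cmult) simp
  also have "ennreal (2 - 0) + ennreal (1 - - 1) = ennreal 2 * 2"
    by (simp flip: ennreal_plus ennreal_numeral ennreal_mult')
  finally have "ennreal 2 * 2 \<le> ennreal 2 * ?R" .
  then show ?thesis
    by (subst (asm) ennreal_mult_le_mult_iff) auto
qed

text \<open>The four arcs are translates of the first by multiples of \<open>pi/2\<close>, and such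
  shifts only change signs of \<open>cos\<close> and \<open>sin\<close> or swap them. On the first
  arc both \<open>x\<close> and \<open>pi/2 - x\<close> are at least \<beta>, and \<open>cos\<close>
  decreases there.\<close>

lemma abs_cos_sin_le_of_J_set:
  assumes "0 < \<beta>" "\<beta> \<le> pi/4" and "\<theta> \<in> J_set \<beta>"
  shows "\<bar>cos \<theta>\<bar> \<le> cos \<beta>" and "\<bar>sin \<theta>\<bar> \<le> cos \<beta>"
proof -
  have A: "\<bar>cos x\<bar> \<le> cos \<beta> \<and> \<bar>sin x\<bar> \<le> cos \<beta>" if "\<beta> \<le> x" "x \<le> pi/2 - \<beta>" for x
  proof -
    have "cos x \<le> cos \<beta>" "cos (pi/2 - x) \<le> cos \<beta>" "0 \<le> cos x" "0 \<le> sin x"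
      using that assms(1)
      by (auto intro!: cos_monotone_0_pi_le cos_ge_zero sin_ge_zero)
    then show ?thesis
      by (simp add: cos_diff)
  qed
  have B: "\<theta> \<in> {\<beta> .. pi/2 - \<beta>} \<or> \<theta> - pi/2 \<in> {\<beta> .. pi/2 - \<beta>} \<or>
      \<theta> - pi \<in> {\<beta> .. pi/2 - \<beta>} \<or> \<theta> - 3*pi/2 \<in> {\<beta> .. pi/2 - \<beta>}"
    using assms(3) unfolding J_set_measurable(1)[OF assms(1)] by auto
  have c3: "cos (3*pi/2) = 0" "sin (3*pi/2) = -1"
    using cos_3over2_pi sin_3over2_pi by simp_all
  from B have "\<bar>cos \<theta>\<bar> \<le> cos \<beta> \<and> \<bar>sin \<theta>\<bar> \<le> cos \<beta>"
    using A[of \<theta>] A[of "\<theta> - pi/2"] A[of "\<theta> - pi"] A[of "\<theta> - 3*pi/2"]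
    by (auto simp: cos_diff sin_diff c3)
  then show "\<bar>cos \<theta>\<bar> \<le> cos \<beta>" "\<bar>sin \<theta>\<bar> \<le> cos \<beta>" by auto
qed

lemma displacement_seg_angle:
  shows "(y - x) $ 1 = dist x y * cos (seg_angle x y)"
    and "(y - x) $ 2 = dist x y * sin (seg_angle x y)"
proof -
  let ?z = "Complex ((y - x) $ 1) ((y - x) $ 2)"
  have "cmod ?z = dist x y"
    by (simp add: complex_norm dist_norm norm_vec_def L2_set_def sum_2 power2_commute)
  then have "?z = of_real (dist x y) * exp (\<i> * of_real (seg_angle x y))"
    using Arg2pi_eq[of ?z] by (simp add: seg_angle_def)
  then have "?z = dist x y * cis (seg_angle x y)"
    by (simp add: cis_conv_exp)
  then show "(y - x) $ 1 = dist x y * cos (seg_angle x y)"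
    and "(y - x) $ 2 = dist x y * sin (seg_angle x y)"
    by (simp_all add: complex_eq_iff)
qed

text \<open>Adding \<open>pi\<close> flips both signs and \<open>rmod\<close> removes whole periods.
  Hence the two atoms of a segment obey the same bounds.\<close>

lemma abs_cos_sin_rmod_pi:
  "\<bar>cos ((\<theta> + pi) rmod (2*pi))\<bar> = \<bar>cos \<theta>\<bar>" "\<bar>sin ((\<theta> + pi) rmod (2*pi))\<bar> = \<bar>sin \<theta>\<bar>"
proof -
  obtain k :: int where k: "(\<theta> + pi) rmod (2*pi) = \<theta> + pi - 2 * pi * of_int k"
    unfolding rmod_def by (metis abs_of_pos mult.commute pi_gt_zero zero_less_mult_iff zero_less_numeral)
  show "\<bar>cos ((\<theta> + pi) rmod (2*pi))\<bar> = \<bar>cos \<theta>\<bar>" "\<bar>sin ((\<theta> + pi) rmod (2*pi))\<bar> = \<bar>sin \<theta>\<bar>"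
    unfolding k by (simp_all add: cos_diff sin_diff)
qed

text \<open>The additive form avoids subtraction in \<open>ennreal\<close>, where the total length
  may be infinite. It follows by summing the inequality \<open>pointwise\<close> over the segments
  and bounding the sum of the \<open>?m i\<close> below by 2.\<close>

lemma orientation_measure_J_set_bound:
  assumes "countable I" and "opaque_for (segments_union I p q) unit_square"
    and \<beta>: "0 < \<beta>" "\<beta> \<le> pi/4"
  shows "2 + ennreal (1 - cos \<beta>) * emeasure (orientation_measure I p q) (J_set \<beta>)
    \<le> total_length I p q"
proof -
  let ?m = "\<lambda>i. max \<bar>(q i - p i) $ 1\<bar> \<bar>(q i - p i) $ 2\<bar>"
  let ?a = "\<lambda>i. seg_angle (p i) (q i)"
  let ?b = "\<lambda>i. (seg_angle (p i) (q i) + pi) rmod (2*pi)"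
  let ?w = "\<lambda>i. indicator (J_set \<beta>) (?a i) + indicator (J_set \<beta>) (?b i)"
  have pointwise: "?m i + (1 - cos \<beta>) * (dist (p i) (q i) / 2 * ?w i) \<le> dist (p i) (q i)" for i
  proof -
    let ?d = "dist (p i) (q i)"
    have m: "?m i = ?d * max \<bar>cos (?a i)\<bar> \<bar>sin (?a i)\<bar>"
      by (simp only: displacement_seg_angle abs_mult)
        (simp add: max_mult_distrib_left)
    show ?thesis
    proof (cases "?a i \<in> J_set \<beta> \<or> ?b i \<in> J_set \<beta>")
      case True
      then have "max \<bar>cos (?a i)\<bar> \<bar>sin (?a i)\<bar> \<le> cos \<beta>"
        using abs_cos_sin_le_of_J_set[OF \<beta>] abs_cos_sin_rmod_pi by (metis max.boundedI)
      then have "?m i \<le> ?d * cos \<beta>"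
        unfolding m by (intro mult_left_mono) auto
      \<comment> \<open>Each of the two antipodal atoms carries half the length, so together they
        contribute at most \<open>?d\<close>.\<close>
      moreover have "?d / 2 * ?w i \<le> ?d / 2 * 2"
        by (intro mult_left_mono) (auto simp: indicator_def)
      then have "(1 - cos \<beta>) * (?d / 2 * ?w i) \<le> (1 - cos \<beta>) * ?d"
        by (intro mult_left_mono) auto
      ultimately have "?m i + (1 - cos \<beta>) * (?d / 2 * ?w i) \<le> ?d * cos \<beta> + (1 - cos \<beta>) * ?d"
        by (rule add_mono)
      also have "\<dots> = ?d" by (simp add: algebra_simps)
      finally show ?thesis .
    next
      case False
      \<comment> \<open>Neither atom lies in the arcs, so the measure term vanishes and the trivial
        bound suffices.\<close>
      have "?m i \<le> ?d * 1"
        unfolding m by (intro mult_left_mono) auto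
      with False show ?thesis by simp
    qed
  qed
  have w: "ennreal (?w i) = indicator (J_set \<beta>) (?a i) + indicator (J_set \<beta>) (?b i)" for i
    by (simp add: indicator_def)
  have "2 + ennreal (1 - cos \<beta>) * emeasure (orientation_measure I p q) (J_set \<beta>)
    \<le> (\<integral>\<^sup>+i. ennreal (?m i) \<partial>count_space I) + ennreal (1 - cos \<beta>) *
        (\<integral>\<^sup>+i. ennreal (dist (p i) (q i) / 2) * ennreal (?w i) \<partial>count_space I)"
    using J_set_measurable(2)[OF \<beta>(1)] unit_square_max_sum[OF assms(1,2)]
    by (simp add: emeasure_orientation_measure[OF assms(1)] sets_orientation_measure w
        infsum_eq_nn_integral_count_space[OF assms(1)] add_right_mono)
  also have "\<dots> = (\<integral>\<^sup>+i. ennreal (?m i + (1 - cos \<beta>) * (dist (p i) (q i) / 2 * ?w i)) \<partial>count_space I)"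
    by (subst nn_integral_cmult[symmetric], simp, subst nn_integral_add[symmetric])
      (auto intro!: nn_integral_cong simp: ennreal_mult'[symmetric] ennreal_mult''[symmetric]
        ennreal_plus[symmetric] simp del: ennreal_plus)
  also have "\<dots> \<le> total_length I p q"
    unfolding total_length_def infsum_eq_nn_integral_count_space[OF assms(1)]
    by (intro nn_integral_mono ennreal_leI pointwise)
  finally show ?thesis .
qed

theorem mainTheorem2:
  fixes I :: "'i set" and p q :: "'i \<Rightarrow> real^2"
    and \<O> :: "(real^2) set" and L :: ennreal
  assumes "segment_family I p q"
    and "\<O> = segments_union I p q"
    and "L = total_length I p q"
    and "opaque_for \<O> unit_square"
  shows "\<forall>\<eta>::real. \<eta> > 0 \<longrightarrow>
    (L \<ge> 2 + ennreal \<eta> \<or>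
     (\<forall>\<beta>::real. 0 \<le> \<beta> \<and> \<beta> \<le> pi/4 \<longrightarrow>
        emeasure (orientation_measure I p q) (J_set \<beta>)
          \<le> (if \<beta> = 0 then \<infinity> else ennreal (\<eta> / (1 - cos \<beta>)))))"
proof (intro allI impI)
  fix \<eta> :: real assume \<eta>: "0 < \<eta>"
  show "L \<ge> 2 + ennreal \<eta> \<or>
     (\<forall>\<beta>::real. 0 \<le> \<beta> \<and> \<beta> \<le> pi/4 \<longrightarrow>
        emeasure (orientation_measure I p q) (J_set \<beta>)
          \<le> (if \<beta> = 0 then \<infinity> else ennreal (\<eta> / (1 - cos \<beta>))))"
  proof (subst disj_commute, rule disjCI, intro allI impI)
    fix \<beta> :: real
    let ?\<mu> = "emeasure (orientation_measure I p q) (J_set \<beta>)"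
    assume L: "\<not> 2 + ennreal \<eta> \<le> L" and \<beta>: "0 \<le> \<beta> \<and> \<beta> \<le> pi/4"
    show "?\<mu> \<le> (if \<beta> = 0 then \<infinity> else ennreal (\<eta> / (1 - cos \<beta>)))"
    proof (cases "\<beta> = 0")
      case False
      with \<beta> have pos: "0 < \<beta>" by simp
      have "cos \<beta> < cos 0"
        using pos \<beta> by (intro cos_monotone_0_pi) auto
      then have c: "0 < 1 - cos \<beta>" by simp
      have "2 + ennreal (1 - cos \<beta>) * ?\<mu> \<le> L"
        using orientation_measure_J_set_bound[of I p q \<beta>] assms pos \<beta>
        by (simp add: segment_family_def)
      also have "L \<le> 2 + ennreal \<eta>" using L by simp
      \<comment> \<open>The summand 2 is finite, so it cancels in \<open>ennreal\<close>.\<close>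
      finally have "ennreal (1 - cos \<beta>) * ?\<mu> \<le> ennreal \<eta>"
        by (simp add: ennreal_add_left_cancel_le)
      \<comment> \<open>Multiplying by the real reciprocal, legitimate by \<open>c\<close>, isolates
        \<open>?\<mu>\<close> even before it is known to be finite.\<close>
      then have "ennreal (1 / (1 - cos \<beta>)) * (ennreal (1 - cos \<beta>) * ?\<mu>)
          \<le> ennreal (1 / (1 - cos \<beta>)) * ennreal \<eta>"
        by (rule mult_left_mono) simp
      then have "?\<mu> \<le> ennreal (\<eta> / (1 - cos \<beta>))"
        using c \<eta> by (simp add: mult.assoc[symmetric] ennreal_mult'[symmetric])
      with False show ?thesis by simp
    qed simp
  qed
qed

end
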